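(* Consider the game ${\rm SCN}(4,2)$ (Shrinking Circular Nim with initial number of piles $n=4$ and $k=2$). Its P-positions (among all configurations that can arise, i.e. circular arrangements of at most $4$ piles, each pile containing a positive integer number of stones) are exactly: the terminal configuration $()$; the configurations $(a,a,a)$ with $a\ge 1$; and the configurations $(a,b,a,b)$ with $a,b\ge 1$ and $a\neq b$.
   Context: Shrinking Circular Nim ${\rm SCN}(n,k)$, for positive integers $k\le n$: initially $n$ piles of stones are arranged on a circle. Two players alternate turns. On a turn, a player selects $k$ consecutive (cyclically adjacent) piles among the currently remaining piles and removes any number of stones from each of them, removing at least one stone in total (some of the selected piles may be left untouched). Whenever a pile becomes empty it vanishes and the circle closes up: the remaining piles keep their cyclic order and the neighbours of the vanished pile become adjacent. If at most $k$ piles remain, a move may remove stones from any of the remaining piles (all of them may be selected). The player who removes the last stone wins (a player with no move loses). A configuration is written as the tuple $(x_1,\dots,x_r)$ of the positive pile sizes in cyclic order; tuples that agree up to rotation or reflection denote the same configuration, and $()$ denotes the empty (terminal) configuration. A P-position is a configuration from which the player to move loses under optimal play by the opponent. *)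

theory Defs
  imports Main
begin

text \<open>A configuration is represented by the tuple of its pile sizes, read off in cyclic order from
  an arbitrary starting pile and in an arbitrary direction.  Tuples related by \<open>same_config\<close> denote
  the same configuration.\<close>

definition scn_configs :: "nat \<Rightarrow> nat list set" where
  "scn_configs n = {xs. length xs \<le> n \<and> (\<forall>x\<in>set xs. x \<ge> 1)}"

definition same_config :: "nat list \<Rightarrow> nat list \<Rightarrow> bool" where
  "same_config xs ys \<longleftrightarrow> (\<exists>i. xs = rotate i ys \<or> xs = rotate i (rev ys))"

text \<open>The \<open>k\<close> cyclically consecutive positions starting at \<open>i\<close>, among \<open>r\<close> piles.  If \<open>0 < r \<le> k\<close>,
  these are all positions.\<close>

definition scn_window :: "nat \<Rightarrow> nat \<Rightarrow> nat \<Rightarrow> nat set" where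
  "scn_window r k i = {(i + j) mod r | j. j < k}"

text \<open>Here \<open>zs\<close> is the tuple after the removal of stones but before the emptied piles vanish;
  deleting its zero entries closes up the circle.\<close>

definition scn_move :: "nat \<Rightarrow> nat list \<Rightarrow> nat list \<Rightarrow> bool" where
  "scn_move k xs ys \<longleftrightarrow>
     (\<exists>i zs. i < length xs \<and> length zs = length xs \<and>
        (\<forall>p < length xs. zs ! p \<le> xs ! p) \<and>
        (\<forall>p < length xs. p \<notin> scn_window (length xs) k i \<longrightarrow> zs ! p = xs ! p) \<and>
        zs \<noteq> xs \<and>
        ys = filter (\<lambda>z. z > 0) zs)"

text \<open>Normal play: the player to move wins if some move leads to a position lost for the opponent,
  and loses if every move (possibly there is none) leads to a position won for the opponent.  The
  least fixed point expresses that the win can be forced in finitely many moves; every play is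
  finite, as each move removes a stone.\<close>

inductive scn_wins :: "nat \<Rightarrow> nat list \<Rightarrow> bool" and scn_loses :: "nat \<Rightarrow> nat list \<Rightarrow> bool"
  for k :: nat where
  wins: "scn_move k xs ys \<Longrightarrow> scn_loses k ys \<Longrightarrow> scn_wins k xs"
| loses: "(\<And>ys. scn_move k xs ys \<Longrightarrow> scn_wins k ys) \<Longrightarrow> scn_loses k xs"

definition scn_P_positions :: "nat \<Rightarrow> nat \<Rightarrow> nat list set" where
  "scn_P_positions n k = {xs \<in> scn_configs n. scn_loses k xs}"

end

theory Submission
  imports Defs
begin

text \<open>The claimed positions form a kernel of the move graph: no move joins two of them, and from
  every other position a move reaches one. With four piles, lowering one pile of each opposite pair to
  the minimum of its pair is a legal move, since the two piles lowered are adjacent. If the two minima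
  differ, the result is \<open>(a,b,a,b)\<close>; if they agree, empty one of these two adjacent piles instead and
  reach \<open>(a,a,a)\<close>.\<close>

text \<open>Provides the termination measure for \<open>scn_loses_iff_kernel\<close>. Deleting zero
  entries leaves the sum unchanged, so only the removed stones count.\<close>

lemma scn_move_sum_list_less:
  assumes "scn_move k xs ys"
  shows "sum_list ys < sum_list xs"
proof -
  obtain zs where zs: "length zs = length xs" "\<forall>p<length xs. zs ! p \<le> xs ! p" "zs \<noteq> xs"
    and ys: "ys = filter (\<lambda>z. z > 0) zs"
    using assms unfolding scn_move_def by blast
  obtain p where "p < length xs" "zs ! p \<noteq> xs ! p"
    using zs(1,3) nth_equalityI by metis
  then have "(\<Sum>p = 0..<length xs. zs ! p) < (\<Sum>p = 0..<length xs. xs ! p)"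
    using zs(2) by (intro sum_strict_mono_ex1) (auto intro!: bexI[of _ p] simp: le_neq_implies_less)
  moreover have "sum_list ys = sum_list zs"
    unfolding ys by (induction zs) auto
  ultimately show ?thesis
    by (simp add: sum_list_sum_nth zs(1))
qed

lemma scn_move_configs:
  assumes "scn_move k xs ys" "xs \<in> scn_configs n"
  shows "ys \<in> scn_configs n"
  using assms unfolding scn_move_def scn_configs_def
  by (auto intro: order_trans[OF length_filter_le])

text \<open>A player facing a position of \<open>K\<close> must leave \<open>K\<close>, and the
  opponent can answer by returning to \<open>K\<close> with fewer stones; induction on the number of
  stones then gives the loss.\<close>

lemma scn_loses_iff_kernel:
  assumes stable: "\<And>xs ys. xs \<in> scn_configs n \<Longrightarrow> xs \<in> K \<Longrightarrow> scn_move k xs ys \<Longrightarrow> ys \<notin> K"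
    and absorbing: "\<And>xs. xs \<in> scn_configs n \<Longrightarrow> xs \<notin> K \<Longrightarrow> \<exists>ys\<in>K. scn_move k xs ys"
    and xs: "xs \<in> scn_configs n"
  shows "scn_loses k xs \<longleftrightarrow> xs \<in> K"
proof
  \<comment> \<open>The two predicates are mutually inductive, so both claims are proved together. A
    winning move from \<open>K\<close> would end in \<open>K\<close> against \<open>stable\<close>;
    a losing position outside \<open>K\<close> would have a move into \<open>K\<close>, to a
    position that wins and hence lies outside \<open>K\<close>.\<close>
  have "(scn_wins k us \<longrightarrow> us \<in> scn_configs n \<longrightarrow> us \<notin> K) \<and>
        (scn_loses k vs \<longrightarrow> vs \<in> scn_configs n \<longrightarrow> vs \<in> K)" for us vs
  proof (induction rule: scn_wins_scn_loses.induct)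
    case (wins xs ys)
    then show ?case using stable scn_move_configs by blast
  next
    case (loses xs)
    then show ?case using absorbing scn_move_configs by blast
  qed
  then show "scn_loses k xs \<Longrightarrow> xs \<in> K" using xs by blast
next
  show "xs \<in> K \<Longrightarrow> scn_loses k xs"
    using xs
  proof (induction "sum_list xs" arbitrary: xs rule: less_induct)
    case less
    show ?case
    proof (rule scn_wins_scn_loses.loses)
      fix ys assume ys: "scn_move k xs ys"
      have ys': "ys \<in> scn_configs n" "ys \<notin> K"
        using scn_move_configs stable ys less.prems by blast+
      then obtain vs where vs: "vs \<in> K" "scn_move k ys vs"
        using absorbing by blast
      have "sum_list vs < sum_list xs"
        using scn_move_sum_list_less[OF ys] scn_move_sum_list_less[OF vs(2)] by simp
      then have "scn_loses k vs"
        using less.hyps vs scn_move_configs ys'(1) by blast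
      then show "scn_wins k ys"
        using vs(2) by (blast intro: scn_wins_scn_loses.wins)
    qed
  qed
qed

lemma scn_window_2: "scn_window r 2 i = {i mod r, Suc i mod r}"
proof -
  have "scn_window r 2 i = (\<lambda>j. (i + j) mod r) ` {..<2}"
    unfolding scn_window_def by blast
  then show ?thesis
    by (simp add: numeral_2_eq_2 lessThan_Suc insert_commute)
qed

lemma same_config_3: "same_config xs [a, a, a] \<longleftrightarrow> xs = [a, a, a]"
proof -
  have "rotate i [a, a, a] = [a, a, a]" for i
    by (induction i) (auto simp: rotate_def)
  then show ?thesis by (simp add: same_config_def)
qed

lemma same_config_4:
  "same_config xs [a, b, a, b] \<longleftrightarrow> xs = [a, b, a, b] \<or> xs = [b, a, b, a]"
proof -
  \<comment> \<open>General in \<open>a\<close> and \<open>b\<close> because reversal exchanges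
    them.\<close>
  have r: "rotate i [a, b, a, b] = (if even i then [a, b, a, b] else [b, a, b, a])" for i and a b :: nat
    by (induction i) (auto simp: rotate_def)
  show ?thesis
    unfolding same_config_def rev.simps append.simps r
    by (auto intro: exI[of _ 0] exI[of _ 1])
qed

text \<open>Plain tuples suffice: rotation and reflection fix \<open>[a, a, a]\<close> and at most
  exchange \<open>a\<close> and \<open>b\<close> in \<open>[a, b, a, b]\<close>.\<close>

definition scn42_kernel :: "nat list set" where
  "scn42_kernel = {[]} \<union> {[a, a, a] | a. a \<ge> 1} \<union> {[a, b, a, b] | a b. a \<ge> 1 \<and> b \<ge> 1 \<and> a \<noteq> b}"

lemma scn42_configs_cases:
  assumes "xs \<in> scn_configs 4"
  obtains "xs = []" | a where "xs = [a]" "a \<ge> 1" | a b where "xs = [a, b]" "a \<ge> 1" "b \<ge> 1"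
  | a b c where "xs = [a, b, c]" "a \<ge> 1" "b \<ge> 1" "c \<ge> 1"
  | a b c d where "xs = [a, b, c, d]" "a \<ge> 1" "b \<ge> 1" "c \<ge> 1" "d \<ge> 1"
proof -
  have len: "length xs \<le> 4" and pos: "\<forall>x\<in>set xs. x \<ge> 1"
    using assms by (simp_all add: scn_configs_def)
  consider "length xs = 0" | "length xs = 1" | "length xs = 2" | "length xs = 3" | "length xs = 4"
    using len by linarith
  then show thesis
  proof cases
    case 1
    then show thesis using that(1) by simp
  next
    case 2
    then obtain a where "xs = [a]"
      by (auto simp: length_Suc_conv)
    then show thesis using that(2) pos by simp
  next
    case 3
    then obtain a b where "xs = [a, b]"
      by (auto simp: length_Suc_conv numeral_eq_Suc)
    then show thesis using that(3) pos by simp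
  next
    case 4
    then obtain a b c where "xs = [a, b, c]"
      by (auto simp: length_Suc_conv numeral_eq_Suc)
    then show thesis using that(4) pos by simp
  next
    case 5
    then obtain a b c d where "xs = [a, b, c, d]"
      by (auto simp: length_Suc_conv numeral_eq_Suc)
    then show thesis using that(5) pos by simp
  qed
qed

lemma scn_move_2I:
  assumes "i < length xs" "length zs = length xs"
    "\<forall>p<length xs. zs ! p \<le> xs ! p \<and> (zs ! p = xs ! p \<or> p = i \<or> p = Suc i mod length xs)"
    "zs \<noteq> xs" "ys = filter (\<lambda>z. z > 0) zs"
  shows "scn_move 2 xs ys"
  unfolding scn_move_def scn_window_2 using assms by (intro exI[of _ i] exI[of _ zs]) auto

lemma scn42_kernel_stable:
  assumes "xs \<in> scn42_kernel" "scn_move 2 xs ys"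
  shows "ys \<notin> scn42_kernel"
proof -
  obtain i zs where m: "i < length xs" "length zs = length xs"
    "\<forall>p<length xs. zs ! p \<le> xs ! p"
    "\<forall>p<length xs. p \<notin> {i mod length xs, Suc i mod length xs} \<longrightarrow> zs ! p = xs ! p"
    "zs \<noteq> xs" "ys = filter (\<lambda>z. z > 0) zs"
    using assms(2) unfolding scn_move_def scn_window_2 by blast
  consider "xs = []" | a where "xs = [a, a, a]" "a \<ge> 1"
    | a b where "xs = [a, b, a, b]" "a \<ge> 1" "b \<ge> 1" "a \<noteq> b"
    using assms(1) unfolding scn42_kernel_def by blast
  then show ?thesis
  proof cases
    case 1
    then show ?thesis using m by simp
  next
    case (2 a)
    then obtain p q r where zs: "zs = [p, q, r]"
      using m(2) by (auto simp: length_Suc_conv)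
    have "i \<in> {0, 1, 2}" using m(1) 2 by auto
    \<comment> \<open>Two adjacent positions out of three miss one, so a pile of size
      \<open>a\<close> survives; a kernel position containing it would have to be
      \<open>[a, a, a]\<close> itself.\<close>
    then have "p = a \<or> q = a \<or> r = a"
      using m(4) unfolding 2(1) zs by (elim insertE emptyE) (simp_all add: All_less_Suc2)
    then show ?thesis
      using m(5) 2 by (auto simp: m(6) zs scn42_kernel_def)
  next
    case (3 a b)
    then obtain p q r s where zs: "zs = [p, q, r, s]"
      using m(2) by (auto simp: length_Suc_conv)
    have "i \<in> {0, 1, 2, 3}" using m(1) 3 by auto
    \<comment> \<open>Two adjacent positions out of four meet each opposite pair exactly once. Both
      \<open>a\<close> and \<open>b\<close> survive, which rules out \<open>[]\<close> and three
      equal piles, while four piles would have to be unchanged.\<close>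
    then have "(p = a \<or> r = a) \<and> (q = b \<or> s = b)"
      using m(4) unfolding 3(1) zs by (elim insertE emptyE) (simp_all add: All_less_Suc2)
    then show ?thesis
      using m(5) 3 by (auto simp: m(6) zs scn42_kernel_def)
  qed
qed

lemma scn42_kernel_absorbing:
  assumes "xs \<in> scn_configs 4" "xs \<notin> scn42_kernel"
  shows "\<exists>ys\<in>scn42_kernel. scn_move 2 xs ys"
  using assms(1)
proof (cases rule: scn42_configs_cases)
  case 1
  then show ?thesis using assms(2) by (simp add: scn42_kernel_def)
next
  \<comment> \<open>With one or two piles the window covers everything, so all stones can be taken
    at once.\<close>
  case (2 a)
  then have "scn_move 2 xs []"
    by (intro scn_move_2I[of 0 _ "[0]"]) auto
  then show ?thesis by (auto simp: scn42_kernel_def)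
next
  case (3 a b)
  then have "scn_move 2 xs []"
    by (intro scn_move_2I[of 0 _ "[0, 0]"]) (auto simp: All_less_Suc2)
  then show ?thesis by (auto simp: scn42_kernel_def)
next
  case (4 a b c)
  have ne: "[m, m, m] \<noteq> xs" if "m \<ge> 1" for m
    using assms(2) that by (auto simp: scn42_kernel_def)
  \<comment> \<open>The smallest pile stays. The other two are adjacent on a circle of three, so the
    window starts just after the smallest pile.\<close>
  consider "a \<le> b \<and> a \<le> c" | "b \<le> a \<and> b \<le> c" | "c \<le> a \<and> c \<le> b" by linarith
  then have "\<exists>m\<ge>1. scn_move 2 xs [m, m, m]"
  proof cases
    case 1
    then have "scn_move 2 xs [a, a, a]"
      using 4 ne[of a] by (intro scn_move_2I[of 1 _ "[a, a, a]"]) (auto simp: All_less_Suc2)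
    then show ?thesis using 4 by blast
  next
    case 2
    then have "scn_move 2 xs [b, b, b]"
      using 4 ne[of b] by (intro scn_move_2I[of 2 _ "[b, b, b]"]) (auto simp: All_less_Suc2)
    then show ?thesis using 4 by blast
  next
    case 3
    then have "scn_move 2 xs [c, c, c]"
      using 4 ne[of c] by (intro scn_move_2I[of 0 _ "[c, c, c]"]) (auto simp: All_less_Suc2)
    then show ?thesis using 4 by blast
  qed
  then show ?thesis by (auto simp: scn42_kernel_def)
next
  case (5 a b c d)
  let ?m = "min a c" and ?n = "min b d"
  have pos: "?m \<ge> 1" "?n \<ge> 1" using 5 by auto
  show ?thesis
  proof (cases "?m = ?n")
    case False
    then have "[?m, ?n, ?m, ?n] \<in> scn42_kernel"
      using pos by (auto simp: scn42_kernel_def)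
    moreover from this have ne: "[?m, ?n, ?m, ?n] \<noteq> xs"
      using assms(2) by blast
    \<comment> \<open>One larger pile from positions 0 and 2 and one from 1 and 3 are lowered;
      \<open>i\<close> is the first of these two in cyclic order.\<close>
    define i :: nat where
      "i = (if a \<le> c then if b \<le> d then 2 else 1 else if b \<le> d then 3 else 0)"
    have "scn_move 2 xs [?m, ?n, ?m, ?n]"
      by (rule scn_move_2I[of i _ "[?m, ?n, ?m, ?n]"])
        (use 5 ne pos in \<open>auto simp: All_less_Suc2 i_def\<close>)
    ultimately show ?thesis by blast
  next
    case True
    then have K: "[?m, ?m, ?m] \<in> scn42_kernel"
      using pos by (auto simp: scn42_kernel_def)
    \<comment> \<open>In each case the pile at the window's start is emptied and the next one
      lowered to the common minimum. Emptying a positive pile ensures that a stone is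
      removed.\<close>
    consider "a \<le> c" "b \<le> d" | "a \<le> c" "d \<le> b" | "c \<le> a" "b \<le> d" | "c \<le> a" "d \<le> b"
      by linarith
    then have "scn_move 2 xs [?m, ?m, ?m]"
    proof cases
      case 1
      then show ?thesis using 5 True
        by (intro scn_move_2I[of 2 _ "[a, b, 0, b]"]) (auto simp: All_less_Suc2)
    next
      case 2
      then show ?thesis using 5 True
        by (intro scn_move_2I[of 1 _ "[a, 0, a, d]"]) (auto simp: All_less_Suc2)
    next
      case 3
      then show ?thesis using 5 True
        by (intro scn_move_2I[of 3 _ "[c, b, c, 0]"]) (auto simp: All_less_Suc2)
    next
      case 4
      then show ?thesis using 5 True
        by (intro scn_move_2I[of 0 _ "[0, d, c, d]"]) (auto simp: All_less_Suc2)
    qed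
    then show ?thesis using K by blast
  qed
qed

theorem theorem2p3:
  "scn_P_positions 4 2 =
     {[]}
     \<union> {xs. \<exists>a\<ge>1. same_config xs [a, a, a]}
     \<union> {xs. \<exists>a b. a \<ge> 1 \<and> b \<ge> 1 \<and> a \<noteq> b \<and> same_config xs [a, b, a, b]}"
proof -
  \<comment> \<open>\<open>scn_loses_iff_kernel\<close> decides membership only within
    \<open>scn_configs 4\<close>; this inclusion upgrades it to an equality of sets.\<close>
  have "scn42_kernel \<subseteq> scn_configs 4"
    by (auto simp: scn42_kernel_def scn_configs_def)
  then have "scn_P_positions 4 2 = scn42_kernel"
    unfolding scn_P_positions_def
    using scn_loses_iff_kernel[of 4 scn42_kernel 2] scn42_kernel_stable scn42_kernel_absorbing
    by blast
  also have "\<dots> = {[]}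
     \<union> {xs. \<exists>a\<ge>1. same_config xs [a, a, a]}
     \<union> {xs. \<exists>a b. a \<ge> 1 \<and> b \<ge> 1 \<and> a \<noteq> b \<and> same_config xs [a, b, a, b]}"
    unfolding scn42_kernel_def same_config_3 same_config_4 by blast
  finally show ?thesis .
qed

end
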